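(* Assume: (E1) $X$ is a compact connected Hausdorff space and $\Phi\colon G\to\mathrm{Homeo}(X)$, $g\mapsto\Phi_g$, is an action of a topological group $G$ by homeomorphisms; (E2) each observation map $h_\alpha\colon X\to Y_\alpha$ ($\alpha\in A$) is continuous and the family jointly separates points, i.e. for all $x\neq x'$ in $X$ there is $\alpha\in A$ with $h_\alpha(x)\neq h_\alpha(x')$; (E3) equivariance holds: $h_\alpha\circ\Phi_g=T^g_\alpha\circ h_\alpha$ for all $\alpha\in A$, $g\in G$; (E4) interventional faithfulness: for every $x\neq x'$ in $X$ there exist $\pi\in\Pi$ and $k\in K$ with $P^{\pi,k}(\cdot\mid x)\neq P^{\pi,k}(\cdot\mid x')$. Let $H=(h_\alpha)_{\alpha\in A}\colon X\to\prod_\alpha Y_\alpha$. Let $z\colon\prod_\alpha Y_\alpha\to Z$ be continuous, predictively sufficient in the sense that every $P^{\pi,k}$ factors through $z$, and equivariant for an action $\Psi$ of $G$ on $Z$, that is, $z\circ\bigl(\prod_\alpha T^g_\alpha\bigr)=\Psi_g\circ z$ for every $g\in G$. Then the composite $\varphi:=z\circ H\colon X\to Z$ is a homeomorphism onto its image and satisfies $\varphi\circ\Phi_g=\Psi_g\circ\varphi$ for every $g\in G$. If $\varphi'$ is any second map with the same properties, then $\tau:=\varphi'^{-1}\circ\varphi$ is a homeomorphism of $X$ commuting with every $\Phi_g$, that is, $\tau\in Z_{\mathrm{Homeo}(X)}(\Phi(G))$, the centraliser of the action. The latent space $X$ is therefore determined up to this centraliser, and not merely up to an arbitrary homeomorp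hism.
   Context: $A$ is a finite index set of modalities; $Y_\alpha$ is the observation space of modality $\alpha$, and $T^g_\alpha\colon Y_\alpha\to Y_\alpha$ is the transformation of modality $\alpha$ corresponding to $g\in G$. $\prod_\alpha T^g_\alpha$ is the product map $(y_\alpha)_\alpha\mapsto(T^g_\alpha y_\alpha)_\alpha$. $Z$ is the target space of the encoder $z$. $\Pi$ is a countable class of policies and $K$ a countable set of prediction horizons. For $\pi\in\Pi$, $k\in K$, $x\in X$, $P^{\pi,k}(\cdot\mid x)$ is the probability law of the next $k$ multimodal observations when policy $\pi$ is executed from state $x$. "Every $P^{\pi,k}$ factors through $z$" means that for each $\pi,k$ the law $P^{\pi,k}(\cdot\mid x)$ depends on $x$ only through $z(H(x))$. $\mathrm{Homeo}(X)$ is the group of self-homeomorphisms of $X$, and $Z_{\mathrm{Homeo}(X)}(\Phi(G))$ is the subgroup of those commuting with every $\Phi_g$, $g\in G$.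
   Formalization: The formal theorem adds that Z is Hausdorff (otherwise φ need not be a homeomorphism onto its image, e.g. Z indiscrete) and that the second map φ' has the same image as φ (otherwise φ'^{-1}∘φ may be undefined or not onto X). *)

theory Defs
  imports "HOL-Probability.Probability" "HOL-Algebra.Group_Action"
begin

locale topological_group = group G for G (structure) and TG :: "'g topology" +
  assumes topspace_eq: "topspace TG = carrier G"
    and continuous_mult: "continuous_map (prod_topology TG TG) TG (\<lambda>(a, b). a \<otimes> b)"
    and continuous_inv: "continuous_map TG TG (\<lambda>a. inv a)"

text \<open>Elements of \<open>Bij S\<close> are extensional, so the carrier contains exactly one function for
  each self-homeomorphism of the space; the operations are those of \<open>BijGroup\<close>, i.e. composition
  on the underlying set.\<close>

definition homeo_group :: "'x topology \<Rightarrow> ('x \<Rightarrow> 'x) monoid" where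
  "homeo_group X = BijGroup (topspace X)
     \<lparr>carrier := {f \<in> Bij (topspace X). homeomorphic_map X X f}\<rparr>"

definition centralizer :: "('g, 'm) monoid_scheme \<Rightarrow> 'g set \<Rightarrow> 'g set" where
  "centralizer G S = {a \<in> carrier G. \<forall>s\<in>S. a \<otimes>\<^bsub>G\<^esub> s = s \<otimes>\<^bsub>G\<^esub> a}"

definition joint_map :: "'a set \<Rightarrow> ('a \<Rightarrow> 'x \<Rightarrow> 'y) \<Rightarrow> 'x \<Rightarrow> 'a \<Rightarrow> 'y" where
  "joint_map A h x = (\<lambda>\<alpha>\<in>A. h \<alpha> x)"

definition product_map :: "'a set \<Rightarrow> ('a \<Rightarrow> 'y \<Rightarrow> 'y) \<Rightarrow> ('a \<Rightarrow> 'y) \<Rightarrow> 'a \<Rightarrow> 'y" where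
  "product_map A t y = (\<lambda>\<alpha>\<in>A. t \<alpha> (y \<alpha>))"

text \<open>The value \<open>P \<pi> k x\<close> is the law of the next \<open>k\<close> multimodal observations, a probability
  measure on the \<open>k\<close>-fold power (indexed by \<open>{..<k}\<close>) of the product of the observation spaces.
  The \<open>\<sigma>\<close>-algebra carried by that power is left open: \<open>B k\<close> is any measurable space on it, so
  Borel and product \<open>\<sigma>\<close>-algebras are both covered. Since all laws with the same \<open>k\<close> share the
  same \<open>\<sigma>\<close>-algebra, equality of measures is equality of laws.\<close>

definition observation_laws ::
  "'x topology \<Rightarrow> 'a set \<Rightarrow> ('a \<Rightarrow> 'y topology) \<Rightarrow> (nat \<Rightarrow> (nat \<Rightarrow> 'a \<Rightarrow> 'y) measure) \<Rightarrow>
   'p set \<Rightarrow> nat set \<Rightarrow> ('p \<Rightarrow> nat \<Rightarrow> 'x \<Rightarrow> (nat \<Rightarrow> 'a \<Rightarrow> 'y) measure) \<Rightarrow> bool" where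
  "observation_laws X A Y B Pol K P \<longleftrightarrow>
     (\<forall>k\<in>K. space (B k) = (\<Pi>\<^sub>E i\<in>{..<k}. topspace (product_topology Y A))) \<and>
     (\<forall>\<pi>\<in>Pol. \<forall>k\<in>K. \<forall>x\<in>topspace X. P \<pi> k x \<in> space (prob_algebra (B k)))"

text \<open>The two properties asserted of \<open>z \<circ> H\<close>: a homeomorphism onto its image, intertwining the
  two actions.\<close>

definition equivariant_embedding ::
  "('g, 'm) monoid_scheme \<Rightarrow> 'x topology \<Rightarrow> ('g \<Rightarrow> 'x \<Rightarrow> 'x) \<Rightarrow>
   'z topology \<Rightarrow> ('g \<Rightarrow> 'z \<Rightarrow> 'z) \<Rightarrow> ('x \<Rightarrow> 'z) \<Rightarrow> bool" where
  "equivariant_embedding G X \<Phi> Z \<Psi> f \<longleftrightarrow>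
     embedding_map X Z f \<and> (\<forall>g\<in>carrier G. \<forall>x\<in>topspace X. f (\<Phi> g x) = \<Psi> g (f x))"

end

theory Submission
  imports Defs
begin

text \<open>Predictive sufficiency together with faithfulness makes \<open>\<phi>\<close> injective, and a continuous injection
  of a compact space into a Hausdorff space is an embedding. Two equivariant embeddings with the
  same image differ by a self-homeomorphism of \<open>X\<close>, which commutes with the action because both
  embeddings intertwine it with \<open>\<Psi>\<close>.\<close>

text \<open>A homeomorphic map is already bijective, so extensionality is all that
  \<open>Bij\<close> adds.\<close>

lemma carrier_homeo_group:
  "f \<in> carrier (homeo_group X) \<longleftrightarrow> f \<in> extensional (topspace X) \<and> homeomorphic_map X X f"
  by (auto simp: homeo_group_def Bij_def bij_betw_def
      dest: homeomorphic_imp_surjective_map homeomorphic_imp_injective_map)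

lemma homeo_group_funcset:
  assumes "f \<in> carrier (homeo_group X)"
  shows "f \<in> topspace X \<rightarrow> topspace X"
  using assms homeomorphic_imp_surjective_map[of X X f] by (auto simp: carrier_homeo_group)

lemma mult_homeo_group:
  assumes "f \<in> carrier (homeo_group X)" "g \<in> carrier (homeo_group X)"
  shows "f \<otimes>\<^bsub>homeo_group X\<^esub> g = compose (topspace X) f g"
  using assms by (simp add: homeo_group_def BijGroup_def)

text \<open>Both products are extensional composites on \<open>topspace X\<close>, so they are equal
  as functions exactly when they agree at the points of the space.\<close>

lemma centralizer_homeo_group:
  assumes "S \<subseteq> carrier (homeo_group X)"
  shows "f \<in> centralizer (homeo_group X) S \<longleftrightarrow>
    f \<in> carrier (homeo_group X) \<and> (\<forall>s\<in>S. \<forall>x\<in>topspace X. f (s x) = s (f x))"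
proof -
  have "f \<otimes>\<^bsub>homeo_group X\<^esub> s = s \<otimes>\<^bsub>homeo_group X\<^esub> f \<longleftrightarrow>
      (\<forall>x\<in>topspace X. f (s x) = s (f x))"
    if "f \<in> carrier (homeo_group X)" "s \<in> S" for s
  proof -
    have "s \<in> carrier (homeo_group X)"
      using that assms by blast
    then show ?thesis
      using that by (auto simp: mult_homeo_group compose_def fun_eq_iff restrict_def)
  qed
  then show ?thesis
    by (auto simp: centralizer_def)
qed

text \<open>With equal images, both maps are homeomorphisms from \<open>X\<close> onto one subspace
  of \<open>Z\<close>, so the inverse of one can be composed with the other.\<close>

lemma embedding_map_same_image_homeomorphic:
  assumes f: "embedding_map X Z f" and f': "embedding_map X Z f'"
    and image: "f' ` topspace X = f ` topspace X"
  shows "homeomorphic_map X X (inv_into (topspace X) f' \<circ> f)"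
proof -
  let ?W = "subtopology Z (f ` topspace X)"
  have homf: "homeomorphic_map X ?W f" and homf': "homeomorphic_map X ?W f'"
    using f f' image by (simp_all add: embedding_map_def)
  have inj: "inj_on f' (topspace X)"
    using homf' homeomorphic_imp_injective_map by blast
  obtain u where u: "homeomorphic_maps X ?W f' u"
    using homf' homeomorphic_map_maps by blast
  then have "homeomorphic_map ?W X u" and uf': "\<And>x. x \<in> topspace X \<Longrightarrow> u (f' x) = x"
    by (auto simp: homeomorphic_maps_map)
  \<comment> \<open>Being a homeomorphic map depends only on the values on the domain space, so
    agreement with \<open>u\<close> on \<open>?W\<close> transfers the property to
    \<open>inv_into\<close>.\<close>
  moreover have "u y = inv_into (topspace X) f' y" if "y \<in> topspace ?W" for y
  proof -
    have "y \<in> f' ` topspace X"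
      using that image by simp
    then show ?thesis
      using uf' inj by (auto simp: inv_into_f_f)
  qed
  ultimately have "homeomorphic_map ?W X (inv_into (topspace X) f')"
    by (metis homeomorphic_map_eq)
  then show ?thesis
    by (rule homeomorphic_map_compose[OF homf])
qed

text \<open>Applying \<open>f'\<close> to either side of the commutation equation gives
  \<open>\<Psi> g (f x)\<close>, and \<open>f'\<close> is injective. The \<open>restrict\<close> is
  there because the group contains only extensional functions.\<close>

lemma equivariant_embedding_same_image_centralizer:
  assumes \<Phi>: "\<Phi> ` carrier G \<subseteq> carrier (homeo_group X)"
    and f: "equivariant_embedding G X \<Phi> Z \<Psi> f" and f': "equivariant_embedding G X \<Phi> Z \<Psi> f'"
    and image: "f' ` topspace X = f ` topspace X"
  shows "restrict (inv_into (topspace X) f' \<circ> f) (topspace X)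
    \<in> centralizer (homeo_group X) (\<Phi> ` carrier G)"
proof -
  let ?\<tau> = "inv_into (topspace X) f' \<circ> f"
  have "homeomorphic_map X X ?\<tau>"
    using f f' image by (auto simp: equivariant_embedding_def intro!: embedding_map_same_image_homeomorphic)
  then have "homeomorphic_map X X (restrict ?\<tau> (topspace X))"
    by (rule homeomorphic_map_eq) simp
  then have carrier: "restrict ?\<tau> (topspace X) \<in> carrier (homeo_group X)"
    by (simp add: carrier_homeo_group)
  have inj: "inj_on f' (topspace X)"
    using f' homeomorphic_imp_injective_map
    unfolding equivariant_embedding_def embedding_map_def by blast
  have maps: "\<Phi> g x \<in> topspace X" if "g \<in> carrier G" "x \<in> topspace X" for g x
    using \<Phi> that homeo_group_funcset[of "\<Phi> g" X] by auto
  have commute: "?\<tau> (\<Phi> g x) = \<Phi> g (?\<tau> x)" if g: "g \<in> carrier G" and x: "x \<in> topspace X" for g x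
  proof -
    \<comment> \<open>Equal images put \<open>f y\<close> in the range of \<open>f'\<close>, where
      \<open>inv_into\<close> is a genuine right inverse.\<close>
    have \<tau>: "?\<tau> y \<in> topspace X" "f' (?\<tau> y) = f y" if "y \<in> topspace X" for y
      using that image by (simp_all add: inv_into_into f_inv_into_f)
    have "f' (?\<tau> (\<Phi> g x)) = f (\<Phi> g x)"
      by (rule \<tau>(2)[OF maps[OF g x]])
    also have "\<dots> = \<Psi> g (f x)"
      using f g x by (simp add: equivariant_embedding_def)
    also have "\<dots> = \<Psi> g (f' (?\<tau> x))"
      using \<tau> x by simp
    also have "\<dots> = f' (\<Phi> g (?\<tau> x))"
      using f' g \<tau>(1)[OF x] unfolding equivariant_embedding_def by simp
    finally show ?thesis
      using inj_onD[OF inj] \<tau>(1) maps g x by blast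
  qed
  with carrier commute maps show ?thesis
    by (simp add: centralizer_homeo_group[OF \<Phi>])
qed

text \<open>This is the converse direction: \<open>\<tau>\<close> permutes the points of
  \<open>X\<close>, so the image is unchanged, and it can be moved past \<open>\<Phi> g\<close>
  before \<open>f\<close> turns \<open>\<Phi> g\<close> into \<open>\<Psi> g\<close>. Agreement of
  \<open>f'\<close> with the composite is asked only on the space, since values elsewhere are
  arbitrary.\<close>

lemma equivariant_embedding_compose_centralizer:
  assumes \<Phi>: "\<Phi> ` carrier G \<subseteq> carrier (homeo_group X)"
    and f: "equivariant_embedding G X \<Phi> Z \<Psi> f"
    and \<tau>: "\<tau> \<in> centralizer (homeo_group X) (\<Phi> ` carrier G)"
    and f': "\<And>x. x \<in> topspace X \<Longrightarrow> f' x = f (\<tau> x)"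
  shows "equivariant_embedding G X \<Phi> Z \<Psi> f' \<and> f' ` topspace X = f ` topspace X"
proof -
  have hom: "homeomorphic_map X X \<tau>" and carrier: "\<tau> \<in> carrier (homeo_group X)"
    and commute: "\<And>g x. g \<in> carrier G \<Longrightarrow> x \<in> topspace X \<Longrightarrow> \<tau> (\<Phi> g x) = \<Phi> g (\<tau> x)"
    using \<tau> by (auto simp: centralizer_homeo_group[OF \<Phi>] carrier_homeo_group)
  have "homeomorphic_map X (subtopology Z (f ` topspace X)) (f \<circ> \<tau>)"
    using f by (auto simp: equivariant_embedding_def embedding_map_def
        intro: homeomorphic_map_compose[OF hom])
  then have "homeomorphic_map X (subtopology Z (f ` topspace X)) f'"
    by (rule homeomorphic_map_eq) (simp add: f')
  moreover have "f' ` topspace X = f ` \<tau> ` topspace X"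
    using f' by (auto simp: image_image)
  then have image: "f' ` topspace X = f ` topspace X"
    using homeomorphic_imp_surjective_map[OF hom] by simp
  ultimately have "embedding_map X Z f'"
    by (simp add: embedding_map_def)
  moreover have "f' (\<Phi> g x) = \<Psi> g (f' x)" if g: "g \<in> carrier G" and x: "x \<in> topspace X" for g x
  proof -
    have "\<Phi> g x \<in> topspace X" "\<tau> x \<in> topspace X"
      using \<Phi> g x homeo_group_funcset[of "\<Phi> g" X] homeo_group_funcset[OF carrier] by auto
    then show ?thesis
      using f f' commute g x by (simp add: equivariant_embedding_def)
  qed
  ultimately show ?thesis
    using image by (simp add: equivariant_embedding_def)
qed

text \<open>Equality of images is what makes the inverse of \<open>\<phi>'\<close> after
  \<open>\<phi>\<close> a bijection of \<open>X\<close>, so it belongs to the properties shared by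
  the second map. The last conjunct makes the indeterminacy exact: on \<open>X\<close>, the
  admissible maps are precisely the translates of \<open>\<phi>\<close> by the centraliser.\<close>

theorem theorem3p7:
  fixes G :: "('g, 'm) monoid_scheme" and TG :: "'g topology"
    and X :: "'x topology" and \<Phi> :: "'g \<Rightarrow> 'x \<Rightarrow> 'x"
    and A :: "'a set" and Y :: "'a \<Rightarrow> 'y topology"
    and h :: "'a \<Rightarrow> 'x \<Rightarrow> 'y" and T :: "'g \<Rightarrow> 'a \<Rightarrow> 'y \<Rightarrow> 'y"
    and Pol :: "'p set" and K :: "nat set"
    and B :: "nat \<Rightarrow> (nat \<Rightarrow> 'a \<Rightarrow> 'y) measure"
    and P :: "'p \<Rightarrow> nat \<Rightarrow> 'x \<Rightarrow> (nat \<Rightarrow> 'a \<Rightarrow> 'y) measure"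
    and Z :: "'z topology" and \<Psi> :: "'g \<Rightarrow> 'z \<Rightarrow> 'z"
    and z :: "('a \<Rightarrow> 'y) \<Rightarrow> 'z" and \<phi> :: "'x \<Rightarrow> 'z"
  assumes "finite A" and "countable Pol" and "countable K"
    and T_maps: "\<And>g \<alpha>. g \<in> carrier G \<Longrightarrow> \<alpha> \<in> A \<Longrightarrow> T g \<alpha> \<in> topspace (Y \<alpha>) \<rightarrow> topspace (Y \<alpha>)"
    and laws: "observation_laws X A Y B Pol K P"
    and E1_space: "compact_space X" "connected_space X" "Hausdorff_space X"
    and E1_group: "topological_group G TG"
    and E1_action: "\<Phi> \<in> hom G (homeo_group X)"
    and E2_continuous: "\<And>\<alpha>. \<alpha> \<in> A \<Longrightarrow> continuous_map X (Y \<alpha>) (h \<alpha>)"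
    and E2_separating: "\<And>x x'. x \<in> topspace X \<Longrightarrow> x' \<in> topspace X \<Longrightarrow> x \<noteq> x' \<Longrightarrow>
      \<exists>\<alpha>\<in>A. h \<alpha> x \<noteq> h \<alpha> x'"
    and E3: "\<And>\<alpha> g x. \<alpha> \<in> A \<Longrightarrow> g \<in> carrier G \<Longrightarrow> x \<in> topspace X \<Longrightarrow>
      h \<alpha> (\<Phi> g x) = T g \<alpha> (h \<alpha> x)"
    and E4: "\<And>x x'. x \<in> topspace X \<Longrightarrow> x' \<in> topspace X \<Longrightarrow> x \<noteq> x' \<Longrightarrow>
      \<exists>\<pi>\<in>Pol. \<exists>k\<in>K. P \<pi> k x \<noteq> P \<pi> k x'"
    and Z_Hausdorff: "Hausdorff_space Z"
    and z_continuous: "continuous_map (product_topology Y A) Z z"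
    and z_sufficient: "\<And>\<pi> k. \<pi> \<in> Pol \<Longrightarrow> k \<in> K \<Longrightarrow>
      \<exists>Q. \<forall>x\<in>topspace X. P \<pi> k x = Q (z (joint_map A h x))"
    and Psi_action: "group_action G (topspace Z) \<Psi>"
    and z_equivariant: "\<And>g y. g \<in> carrier G \<Longrightarrow> y \<in> topspace (product_topology Y A) \<Longrightarrow>
      z (product_map A (T g) y) = \<Psi> g (z y)"
    and phi_eq: "\<phi> = z \<circ> joint_map A h"
  shows "equivariant_embedding G X \<Phi> Z \<Psi> \<phi>
    \<and> (\<forall>\<phi>'. equivariant_embedding G X \<Phi> Z \<Psi> \<phi>' \<and> \<phi>' ` topspace X = \<phi> ` topspace X \<longrightarrow>
         restrict (inv_into (topspace X) \<phi>' \<circ> \<phi>) (topspace X)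
           \<in> centralizer (homeo_group X) (\<Phi> ` carrier G))
    \<and> (\<forall>\<phi>'. equivariant_embedding G X \<Phi> Z \<Psi> \<phi>' \<and> \<phi>' ` topspace X = \<phi> ` topspace X \<longleftrightarrow>
         (\<exists>\<tau>\<in>centralizer (homeo_group X) (\<Phi> ` carrier G).
            \<forall>x\<in>topspace X. \<phi>' x = \<phi> (\<tau> x)))"
proof -
  have \<Phi>: "\<Phi> ` carrier G \<subseteq> carrier (homeo_group X)"
    using E1_action by (auto simp: hom_def)
  have H: "continuous_map X (product_topology Y A) (joint_map A h)"
    using E2_continuous
    by (auto simp: continuous_map_componentwise joint_map_def)
  have inj: "inj_on \<phi> (topspace X)"
  proof (rule inj_onI)
    fix x x' assume x: "x \<in> topspace X" "x' \<in> topspace X" and eq: "\<phi> x = \<phi> x'"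
    \<comment> \<open>Sufficiency writes each law as a function \<open>Q\<close> of
      \<open>\<phi> x\<close>, so equal values of \<open>\<phi>\<close> leave no policy and horizon
      that could distinguish the points.\<close>
    have "P \<pi> k x = P \<pi> k x'" if "\<pi> \<in> Pol" "k \<in> K" for \<pi> k
      using z_sufficient[OF that] x eq by (auto simp: phi_eq)
    then show "x = x'"
      using E4 x by blast
  qed
  have "continuous_map X Z \<phi>"
    unfolding phi_eq using H z_continuous by (rule continuous_map_compose)
  \<comment> \<open>Closed subsets of \<open>X\<close> are compact, so their images are closed in
    the Hausdorff space \<open>Z\<close>; hence the inverse on the image is continuous.\<close>
  then have "embedding_map X Z \<phi>"
    using E1_space(1) Z_Hausdorff inj by (rule continuous_imp_embedding_map)
  moreover have "\<phi> (\<Phi> g x) = \<Psi> g (\<phi> x)" if g: "g \<in> carrier G" and x: "x \<in> topspace X" for g x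
  proof -
    \<comment> \<open>\<open>E3\<close> gives equality in each coordinate of \<open>A\<close>; at
      other indices both families are \<open>undefined\<close>.\<close>
    have "joint_map A h (\<Phi> g x) = product_map A (T g) (joint_map A h x)"
      using E3 g x by (auto simp: joint_map_def product_map_def restrict_def)
    moreover have "joint_map A h x \<in> topspace (product_topology Y A)"
      using continuous_map_funspace[OF H] x by blast
    ultimately show ?thesis
      using z_equivariant g by (simp add: phi_eq)
  qed
  ultimately have emb: "equivariant_embedding G X \<Phi> Z \<Psi> \<phi>"
    by (simp add: equivariant_embedding_def)
  show ?thesis
  proof (intro conjI allI impI)
    show "equivariant_embedding G X \<Phi> Z \<Psi> \<phi>"
      by (rule emb)
  next
    fix \<phi>'
    assume "equivariant_embedding G X \<Phi> Z \<Psi> \<phi>' \<and> \<phi>' ` topspace X = \<phi> ` topspace X"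
    then show "restrict (inv_into (topspace X) \<phi>' \<circ> \<phi>) (topspace X)
        \<in> centralizer (homeo_group X) (\<Phi> ` carrier G)"
      by (elim conjE) (rule equivariant_embedding_same_image_centralizer[OF \<Phi> emb])
  next
    fix \<phi>'
    show "equivariant_embedding G X \<Phi> Z \<Psi> \<phi>' \<and> \<phi>' ` topspace X = \<phi> ` topspace X \<longleftrightarrow>
      (\<exists>\<tau>\<in>centralizer (homeo_group X) (\<Phi> ` carrier G). \<forall>x\<in>topspace X. \<phi>' x = \<phi> (\<tau> x))"
      (is "?same \<longleftrightarrow> ?translate")
    proof
      assume ?same
      then have emb': "equivariant_embedding G X \<Phi> Z \<Psi> \<phi>'"
        and image: "\<phi>' ` topspace X = \<phi> ` topspace X"
        by auto
      show ?translate
      proof (intro bexI ballI)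
        \<comment> \<open>The roles of the two embeddings are exchanged: solving \<phi>' = \<phi>
          \<circ> \<tau> for \<tau> requires inverting \<open>\<phi>\<close>, not
          \<open>\<phi>'\<close>.\<close>
        show "restrict (inv_into (topspace X) \<phi> \<circ> \<phi>') (topspace X)
            \<in> centralizer (homeo_group X) (\<Phi> ` carrier G)"
          by (rule equivariant_embedding_same_image_centralizer[OF \<Phi> emb' emb image[symmetric]])
        fix x assume x: "x \<in> topspace X"
        then have "\<phi>' x \<in> \<phi> ` topspace X"
          using image by blast
        then show "\<phi>' x = \<phi> (restrict (inv_into (topspace X) \<phi> \<circ> \<phi>') (topspace X) x)"
          using x by (simp add: f_inv_into_f)
      qed
    next
      assume ?translate
      then obtain \<tau> where \<tau>: "\<tau> \<in> centralizer (homeo_group X) (\<Phi> ` carrier G)"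
        and "\<And>x. x \<in> topspace X \<Longrightarrow> \<phi>' x = \<phi> (\<tau> x)"
        by blast
      then show ?same
        by (rule equivariant_embedding_compose_centralizer[OF \<Phi> emb])
    qed
  qed
qed

end
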